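(* Let $k \geq 2$ and $\ell \geq 1$ be integers. Let $D$ be a digraph with $\delta^+(D) \geq k$ and digirth at least $\frac{k^\ell - 1}{k - 1}+1$. Then for every vertex $u$ of $D$, $D$ contains a copy of $S_k^{+(\ell)}$ with centre $u$.
   Context: Digraphs are finite, without loops or parallel arcs. $\delta^+(D)$ is the minimum out-degree. The digirth of $D$ is the length of a shortest directed cycle ($+\infty$ if acyclic). $S_k^{+(\ell)}$ is the digraph consisting of $k$ directed paths of length $\ell$ (i.e. with $\ell$ arcs) sharing their initial vertex and having no other common vertices; its centre is this common initial vertex (its unique source). A copy of it in $D$ is a subdigraph of $D$ isomorphic to it. *)

theory Defs
  imports "Graph_Theory.Digraph_Isomorphism" "HOL-Library.Extended_Nat"
begin

(* Only meaningful for digraphs with at least one vertex, since Min {} is unspecified. *)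
definition min_out_degree :: "('a,'b) pre_digraph \<Rightarrow> nat" where
  "min_out_degree D = Min (out_degree D ` verts D)"

(* The infimum over the empty set is infinity, the value for acyclic digraphs.  The library's
   cycle also admits loops (length 1), which do not occur in a digraph, and cycles of length 2. *)
definition digirth :: "('a,'b) pre_digraph \<Rightarrow> enat" where
  "digirth D = (INF p \<in> {p. pre_digraph.cycle D p}. enat (length p))"

(* The vertex at position j on the i-th path.  Position 0 is the common initial vertex (0,0),
   whatever i is; all other positions on different paths are different vertices. *)
definition arm_vertex :: "nat \<Rightarrow> nat \<Rightarrow> nat \<times> nat" where
  "arm_vertex i j = (if j = 0 then (0, 0) else (i, j))"

definition spider_centre :: "nat \<times> nat" where
  "spider_centre = (0, 0)"

definition out_spider :: "nat \<Rightarrow> nat \<Rightarrow> (nat \<times> nat, (nat \<times> nat) \<times> (nat \<times> nat)) pre_digraph" where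
  "out_spider k l =
    \<lparr> verts = insert spider_centre {arm_vertex i j | i j. i < k \<and> j \<le> l},
      arcs = {(arm_vertex i j, arm_vertex i (Suc j)) | i j. i < k \<and> j < l},
      tail = fst, head = snd \<rparr>"

definition has_out_spider_at :: "('a,'b) pre_digraph \<Rightarrow> nat \<Rightarrow> nat \<Rightarrow> 'a \<Rightarrow> bool" where
  "has_out_spider_at D k l u \<longleftrightarrow>
    (\<exists>H f. subgraph H D \<and>
           pre_digraph.digraph_isomorphism (out_spider k l) f \<and>
           H = app_iso f (out_spider k l) \<and>
           iso_verts f spider_centre = u)"

lemma digraph_out_spider: "digraph (out_spider k l)"
proof -
  have v: "verts (out_spider k l) =
      insert spider_centre ((\<lambda>(i,j). arm_vertex i j) ` ({..<k} \<times> {..l}))"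
    by (auto simp: out_spider_def)
  have a: "arcs (out_spider k l) =
      (\<lambda>(i,j). (arm_vertex i j, arm_vertex i (Suc j))) ` ({..<k} \<times> {..<l})"
    by (auto simp: out_spider_def)
  show ?thesis
  proof
    show "finite (verts (out_spider k l))" unfolding v by simp
    show "finite (arcs (out_spider k l))" unfolding a by simp
    fix e assume "e \<in> arcs (out_spider k l)"
    then obtain i j where ij: "i < k" "j < l" "e = (arm_vertex i j, arm_vertex i (Suc j))"
      by (auto simp: out_spider_def)
    then show "tail (out_spider k l) e \<in> verts (out_spider k l)"
      and "head (out_spider k l) e \<in> verts (out_spider k l)"
      by (fastforce simp: out_spider_def)+
    from ij show "tail (out_spider k l) e \<noteq> head (out_spider k l) e"
      by (auto simp: out_spider_def arm_vertex_def)
  qed (auto simp: out_spider_def arc_to_ends_def)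
qed

lemma spider_centre_unique_source:
  assumes "v \<in> verts (out_spider k l)"
  shows "in_degree (out_spider k l) v = 0 \<longleftrightarrow> v = spider_centre"
proof -
  interpret digraph "out_spider k l" by (rule digraph_out_spider)
  have "in_arcs (out_spider k l) v = {} \<longleftrightarrow> v = spider_centre"
  proof
    assume e: "in_arcs (out_spider k l) v = {}"
    show "v = spider_centre"
    proof (rule ccontr)
      assume "v \<noteq> spider_centre"
      with assms obtain i j where ij: "i < k" "j \<le> l" "v = arm_vertex i j" "j \<noteq> 0"
        by (auto simp: out_spider_def arm_vertex_def spider_centre_def split: if_splits)
      then obtain j' where "j = Suc j'" by (cases j) auto
      with ij have "(arm_vertex i j', v) \<in> in_arcs (out_spider k l) v"
        by (force simp: out_spider_def)
      with e show False by blast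
    qed
  qed (auto simp: in_arcs_def out_spider_def arm_vertex_def spider_centre_def)
  then show ?thesis by (simp add: in_degree_def finite_in_arcs)
qed

end

theory Submission
  imports Defs
begin

text \<open>
  Keep exactly \<open>k\<close> out-neighbours of every vertex and let \<open>B\<close> be the set of vertices reachable from
  \<open>u\<close> in fewer than \<open>l\<close> of the remaining steps.  Then \<open>B\<close> has at most \<open>1 + k + \<dots> + k ^ (l - 1)\<close>
  elements, so by the digirth condition \<open>D\<close> induces an acyclic digraph on \<open>B\<close>.  Put a token on each
  of the \<open>k\<close> out-neighbours of \<open>u\<close> and repeatedly move a token that is earliest in a topological order
  of \<open>B\<close> to an out-neighbour without a token; there is one, because only \<open>k - 1\<close> other tokens exist.
  No token returns to a vertex that was left, so the tokens trace \<open>k\<close> disjoint paths out of \<open>B\<close>.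
  A path leaving \<open>B\<close> must make at least \<open>l\<close> steps, counted from \<open>u\<close>.
\<close>

text \<open>Induction on the total rank deficit below \<open>M\<close> of the token positions
  \<open>A\<close>. The clause that later vertices outrank the start is carried along so that a path
  can be extended backwards without meeting a vertex twice.\<close>

lemma disjoint_paths_to_high_rank:
  fixes r :: "'a \<Rightarrow> nat"
  assumes "finite A" and "card A \<le> k"
    and card: "\<And>x. r x < M \<Longrightarrow> k \<le> card (E `` {x})"
    and mono: "\<And>x y. r x < M \<Longrightarrow> (x, y) \<in> E \<Longrightarrow> r x < r y"
  shows "\<exists>p. (\<forall>a\<in>A. p a \<noteq> [] \<and> hd (p a) = a \<and> M \<le> r (last (p a))
              \<and> successively (\<lambda>x y. (x, y) \<in> E) (p a) \<and> distinct (p a)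
              \<and> (\<forall>x\<in>set (tl (p a)). r a < r x))
           \<and> (\<forall>a\<in>A. \<forall>b\<in>A. a \<noteq> b \<longrightarrow> set (p a) \<inter> set (p b) = {})"
  using assms(1,2)
proof (induction "\<Sum>a\<in>A. M - r a" arbitrary: A rule: less_induct)
  case less
  note [simp] = \<open>finite A\<close>
  show ?case
  proof (cases "\<exists>a\<in>A. r a < M")
    case False
    then show ?thesis by (intro exI[of _ "\<lambda>a. [a]"]) (auto simp: not_less)
  next
    case True
    then have "A \<noteq> {}" by auto
    then obtain a where a: "a \<in> A" and min: "\<And>b. b \<in> A \<Longrightarrow> r a \<le> r b"
      using ex_min_if_finite[of "r ` A"] by (force simp: not_less)
    then have aM: "r a < M" using True le_less_trans by blast
    \<comment> \<open>Pigeonhole: the other tokens occupy at most \<open>k - 1\<close> vertices. The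
      target cannot be \<open>a\<close> itself, because the rank grows along the arc.\<close>
    have "card (A - {a}) < card (E `` {a})"
      using card[OF aM] less.prems a by (meson card_Diff1_less less_le_trans order_trans)
    then have "\<not> E `` {a} \<subseteq> A - {a}" by (meson card_mono \<open>finite A\<close> finite_Diff not_less)
    then obtain a' where a': "(a, a') \<in> E" and "a' \<notin> A - {a}" by blast
    have raa: "r a < r a'" using mono[OF aM a'] .
    then have "a' \<noteq> a" by auto
    with \<open>a' \<notin> A - {a}\<close> have "a' \<notin> A" by simp
    define A' where "A' = insert a' (A - {a})"
    have "(\<Sum>b\<in>A'. M - r b) = (M - r a') + (\<Sum>b\<in>A - {a}. M - r b)"
      using \<open>a' \<notin> A\<close> by (simp add: A'_def)
    \<comment> \<open>Subtraction is truncated at 0, so the drop is strict only because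
      \<open>r a < M\<close>.\<close>
    also have "\<dots> < (M - r a) + (\<Sum>b\<in>A - {a}. M - r b)" using raa aM by simp
    also have "\<dots> = (\<Sum>b\<in>A. M - r b)" using a by (simp add: sum.remove)
    finally have dec: "(\<Sum>b\<in>A'. M - r b) < (\<Sum>b\<in>A. M - r b)" .
    have "finite A'" "card A' \<le> k"
      using a \<open>a' \<notin> A\<close> card.remove[of A a] less.prems by (simp_all add: A'_def)
    then obtain p where
      p: "\<forall>b\<in>A'. p b \<noteq> [] \<and> hd (p b) = b \<and> M \<le> r (last (p b))
              \<and> successively (\<lambda>x y. (x, y) \<in> E) (p b) \<and> distinct (p b)
              \<and> (\<forall>x\<in>set (tl (p b)). r b < r x)"
      and disj: "\<forall>b\<in>A'. \<forall>c\<in>A'. b \<noteq> c \<longrightarrow> set (p b) \<inter> set (p c) = {}"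
      using less.hyps[OF dec] by blast
    note p = bspec[OF p] and disj = disj[rule_format]
    \<comment> \<open>Every start in \<open>A'\<close> differs from \<open>a\<close> and has rank at
      least \<open>r a\<close>, and ranks beyond a start are larger still.\<close>
    have notin: "a \<notin> set (p b)" if "b \<in> A'" for b
    proof
      assume "a \<in> set (p b)"
      moreover have "b \<noteq> a" using that \<open>a' \<noteq> a\<close> by (auto simp: A'_def)
      ultimately have "a \<in> set (tl (p b))" using p[OF that] by (cases "p b") auto
      then have "r b < r a" using p[OF that] by blast
      moreover have "r a \<le> r b" using that min raa by (auto simp: A'_def)
      ultimately show False by simp
    qed
    have a'A: "a' \<in> A'" by (simp add: A'_def)
    have gt: "r a < r x" if "x \<in> set (p a')" for x
    proof (cases "x = a'")
      case False
      with that p[OF a'A] have "x \<in> set (tl (p a'))" by (cases "p a'") auto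
      then have "r a' < r x" using p[OF a'A] by blast
      then show ?thesis using raa by simp
    qed (use raa in simp)
    \<comment> \<open>The token moved from \<open>a\<close> to \<open>a'\<close> traces
      \<open>a\<close> and then the path of \<open>a'\<close>; the other paths stay.\<close>
    define q where "q = p(a := a # p a')"
    have "q b \<noteq> [] \<and> hd (q b) = b \<and> M \<le> r (last (q b))
              \<and> successively (\<lambda>x y. (x, y) \<in> E) (q b) \<and> distinct (q b)
              \<and> (\<forall>x\<in>set (tl (q b)). r b < r x)" if "b \<in> A" for b
    proof (cases "b = a")
      case True
      then show ?thesis
        using p[OF a'A] notin[OF a'A] gt a' by (auto simp: q_def successively_Cons)
    next
      case False
      then have "b \<in> A'" using that by (simp add: A'_def)
      then show ?thesis using p[of b] False by (simp add: q_def)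
    qed
    moreover have "set (q b) \<inter> set (q c) = {}" if "b \<in> A" "c \<in> A" "b \<noteq> c" for b c
    proof -
      have other: "set (q a) \<inter> set (q d) = {}" if "d \<in> A" "d \<noteq> a" for d
      proof -
        have "d \<in> A'" "d \<noteq> a'" using that \<open>a' \<notin> A\<close> by (auto simp: A'_def)
        then show ?thesis using disj[OF a'A, of d] notin that by (auto simp: q_def)
      qed
      show ?thesis
      proof (cases "b = a \<or> c = a")
        case True
        then show ?thesis using other that by blast
      next
        case False
        then show ?thesis using disj[of b c] that by (simp add: q_def A'_def)
      qed
    qed
    ultimately show ?thesis by blast
  qed
qed

section \<open>Growth of balls and lengths of walks\<close>

lemma relpow_Image_bound:
  fixes E :: "('a \<times> 'a) set"
  assumes "\<And>x. finite (E `` {x})" and "\<And>x. card (E `` {x}) \<le> k"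
  shows "finite ((E ^^ i) `` {u}) \<and> card ((E ^^ i) `` {u}) \<le> k ^ i"
proof (induction i)
  case (Suc i)
  have eq: "(E ^^ Suc i) `` {u} = (\<Union>x\<in>(E ^^ i) `` {u}. E `` {x})" by auto
  have "card ((E ^^ Suc i) `` {u}) \<le> (\<Sum>x\<in>(E ^^ i) `` {u}. card (E `` {x}))"
    unfolding eq using Suc by (intro card_UN_le) simp
  also have "\<dots> \<le> (\<Sum>x\<in>(E ^^ i) `` {u}. k)" by (intro sum_mono assms)
  also have "\<dots> \<le> k ^ Suc i" using Suc by simp
  finally show ?case using Suc assms(1) unfolding eq by blast
qed simp

text \<open>The list starts one step after \<open>u\<close>, which shifts the exponent by one
  against the index.\<close>

lemma successively_nth_relpow:
  assumes "successively (\<lambda>x y. (x, y) \<in> E) xs" and "(u, hd xs) \<in> E" and "j < length xs"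
  shows "(u, xs ! j) \<in> E ^^ Suc j"
  using assms(3)
proof (induction j)
  case 0
  then show ?case using assms(2) by (simp add: hd_conv_nth)
next
  case (Suc j)
  then have "(xs ! j, xs ! Suc j) \<in> E" using assms(1) by (simp add: successively_conv_nth)
  with Suc show ?case by auto
qed

lemma geometric_sum_nat:
  fixes k :: nat
  assumes "k \<ge> 2"
  shows "(\<Sum>i<l. k ^ i) = (k ^ l - 1) div (k - 1)"
proof -
  have "(k - 1) * (\<Sum>i<l. k ^ i) = k ^ l - 1"
  proof (induction l)
    case (Suc l)
    have "k ^ l \<ge> 1" using assms by simp
    with Suc show ?case using assms by (simp add: algebra_simps)
  qed simp
  moreover have "k - 1 \<noteq> 0" using assms by simp
  ultimately show ?thesis by (metis nonzero_mult_div_cancel_left)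
qed

section \<open>Digirth and acyclic induced subdigraphs\<close>

lemma (in wf_digraph) cycle_length_le_card_verts:
  assumes "cycle p" and "finite (verts G)"
  shows "length p \<le> card (verts G)"
proof -
  from assms obtain u where u: "awalk u p u" "distinct (tl (awalk_verts u p))"
    unfolding cycle_def by blast
  \<comment> \<open>Dropping the first occurrence of the repeated endpoint leaves one vertex per
    arc.\<close>
  have "length p = card (set (tl (awalk_verts u p)))"
    using distinct_card[OF u(2)] by (simp add: length_awalk_verts)
  also have "\<dots> \<le> card (verts G)"
    using u(1) assms(2)
    by (intro card_mono) (auto elim!: awalkE' dest!: list.set_sel(2)[rotated])
  finally show ?thesis .
qed

text \<open>A closed walk within \<open>B\<close> contains a cycle on at most \<open>card B\<close>
  vertices, which is also a cycle of \<open>G\<close> and is too short for the digirth.\<close>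

lemma (in wf_digraph) acyclic_induce_subgraph_if_card_less_digirth:
  assumes "finite B" and "B \<subseteq> verts G" and "enat (card B) < digirth G"
  shows "acyclic (arcs_ends (G \<restriction> B))"
proof (rule acyclicI, rule allI, rule notI)
  fix v assume v: "(v, v) \<in> (arcs_ends (G \<restriction> B))\<^sup>+"
  have sub: "subgraph (G \<restriction> B) G"
    using assms(2) by (simp add: subgraph_def compatible_def wf_digraph wellformed_induce_subgraph)
  interpret B: wf_digraph "G \<restriction> B" by (rule wellformed_induce_subgraph)
  from v obtain p where "B.closed_w p"
    by (auto simp: B.reachable1_awalk B.closed_w_def)
  then obtain c where c: "B.cycle c" using B.closed_w_imp_cycle by blast
  then have "digirth G \<le> enat (length c)"
    using subgraph_cycle[OF sub] by (auto simp: digirth_def intro!: INF_lower)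
  also have "\<dots> \<le> enat (card B)"
    using B.cycle_length_le_card_verts[OF c] assms(1) by simp
  finally show False using assms(3) by simp
qed

section \<open>Out-degrees and copies of the spider\<close>

lemma (in digraph) card_successors: "card (arcs_ends G `` {x}) = out_degree G x"
proof -
  have "arcs_ends G `` {x} = head G ` out_arcs G x"
    by (auto simp: arcs_ends_conv image_iff)
  moreover have "inj_on (head G) (out_arcs G x)"
    by (auto intro!: inj_onI no_multi_arcs simp: arc_to_ends_def)
  ultimately show ?thesis by (simp add: card_image out_degree_def)
qed

text \<open>An isomorphism must also map arcs. Choosing an arc of \<open>G\<close> between the
  images of the ends is injective, since a spider arc is the pair of its ends and \<open>g\<close>
  is injective.\<close>

lemma (in digraph) has_out_spider_atI:
  assumes "u \<in> verts G" and g0: "g (0, 0) = u"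
    and inj: "inj_on g (verts (out_spider k l))"
    and arcs: "\<And>i j. i < k \<Longrightarrow> j < l \<Longrightarrow> (g (arm_vertex i j), g (arm_vertex i (Suc j))) \<in> arcs_ends G"
  shows "has_out_spider_at G k l u"
proof -
  define h where "h = (\<lambda>(x, y). SOME e. e \<in> arcs G \<and> tail G e = g x \<and> head G e = g y)"
  define f where "f = \<lparr>iso_verts = g, iso_arcs = h, iso_head = head G, iso_tail = tail G\<rparr>"
  interpret S: digraph "out_spider k l" by (rule digraph_out_spider)
  have tail: "tail (out_spider k l) = fst" and head: "head (out_spider k l) = snd"
    by (simp_all add: out_spider_def)
  have h: "h e \<in> arcs G \<and> tail G (h e) = g (fst e) \<and> head G (h e) = g (snd e)"
    if "e \<in> arcs (out_spider k l)" for e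
  proof -
    from that have "(g (fst e), g (snd e)) \<in> arcs_ends G"
      using arcs by (auto simp: out_spider_def)
    then have "\<exists>a. a \<in> arcs G \<and> tail G a = g (fst e) \<and> head G a = g (snd e)"
      by (auto simp: arcs_ends_conv)
    from someI_ex[OF this] show ?thesis by (simp add: h_def split_beta)
  qed
  have "inj_on h (arcs (out_spider k l))"
  proof (rule inj_onI)
    fix e e' assume e: "e \<in> arcs (out_spider k l)" "e' \<in> arcs (out_spider k l)" "h e = h e'"
    then have "g (fst e) = g (fst e')" "g (snd e) = g (snd e')" using h by metis+
    moreover have "fst a \<in> verts (out_spider k l)" "snd a \<in> verts (out_spider k l)"
      if "a \<in> arcs (out_spider k l)" for a
      using S.tail_in_verts[OF that] S.head_in_verts[OF that] by (simp_all add: tail head)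
    ultimately show "e = e'" using e inj by (metis inj_onD prod_eqI)
  qed
  then have iso: "S.digraph_isomorphism f"
    using h inj by (simp add: S.digraph_isomorphism_def f_def tail head S.wf_digraph)
  have "g (arm_vertex i j) \<in> verts G" if "i < k" "j \<le> l" for i j
  proof (cases j)
    case (Suc j')
    then show ?thesis using adj_in_verts(2)[OF arcs[of i j']] that by simp
  qed (use assms in \<open>simp add: arm_vertex_def\<close>)
  then have "g ` verts (out_spider k l) \<subseteq> verts G"
    using assms(1) g0 by (auto simp: out_spider_def spider_centre_def)
  moreover have "wf_digraph (app_iso f (out_spider k l))"
    using iso by (rule S.wf_digraphI_app_iso)
  ultimately have "subgraph (app_iso f (out_spider k l)) G"
    using h by (auto simp: subgraph_def compatible_def f_def wf_digraph)
  moreover have "iso_verts f spider_centre = u" using g0 by (simp add: f_def spider_centre_def)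
  ultimately show ?thesis unfolding has_out_spider_at_def using iso by blast
qed

theorem theorem8:
  fixes D :: "('a, 'b) pre_digraph" and k l :: nat
  assumes "k \<ge> 2" and "l \<ge> 1"
    and "digraph D"
    and "min_out_degree D \<ge> k"
    and "digirth D \<ge> enat ((k ^ l - 1) div (k - 1) + 1)"
  shows "\<forall>u \<in> verts D. has_out_spider_at D k l u"
proof
  fix u assume u: "u \<in> verts D"
  interpret digraph D by fact
  have deg: "k \<le> card (arcs_ends D `` {x})" if "x \<in> verts D" for x
  proof -
    have "min_out_degree D \<le> out_degree D x"
      unfolding min_out_degree_def using that by (intro Min_le) auto
    then show ?thesis using assms(4) by (simp add: card_successors)
  qed
  \<comment> \<open>The minimum out-degree is only a lower bound; trimming to exactly
    \<open>k\<close> successors also bounds the growth of balls around \<open>u\<close>.\<close>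
  have "\<exists>F. F \<subseteq> arcs_ends D `` {x} \<and> card F = k \<and> finite F" if "x \<in> verts D" for x
    using obtain_subset_with_card_n[OF deg[OF that]] by metis
  then obtain F where F: "\<And>x. x \<in> verts D \<Longrightarrow> F x \<subseteq> arcs_ends D `` {x} \<and> card (F x) = k \<and> finite (F x)"
    by metis
  define E where "E = {(x, y). x \<in> verts D \<and> y \<in> F x}"
  have E_Image: "E `` {x} = (if x \<in> verts D then F x else {})" for x
    by (auto simp: E_def)
  have E_arcs: "E \<subseteq> arcs_ends D" using F by (auto simp: E_def)
  define B where "B = (\<Union>i<l. (E ^^ i) `` {u})"
  have bound: "finite ((E ^^ i) `` {u}) \<and> card ((E ^^ i) `` {u}) \<le> k ^ i" for i
    by (rule relpow_Image_bound) (use F in \<open>auto simp: E_Image\<close>)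
  have finB: "finite B" using bound by (auto simp: B_def)
  have "card B \<le> (\<Sum>i<l. card ((E ^^ i) `` {u}))"
    unfolding B_def by (rule card_UN_le) simp
  also have "\<dots> \<le> (\<Sum>i<l. k ^ i)" using bound by (intro sum_mono) blast
  finally have "card B < (k ^ l - 1) div (k - 1) + 1"
    using geometric_sum_nat[OF assms(1)] by simp
  then have "enat (card B) < digirth D"
    using assms(5) by (meson enat_ord_simps(2) less_le_trans)
  have B_verts: "B \<subseteq> verts D"
  proof
    fix x assume "x \<in> B"
    then obtain i where "(u, x) \<in> E ^^ i" by (auto simp: B_def)
    then show "x \<in> verts D"
    proof (cases i)
      case (Suc j)
      with \<open>(u, x) \<in> E ^^ i\<close> obtain y where "(y, x) \<in> E" by auto
      then show ?thesis using E_arcs adj_in_verts(2) by blast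
    qed (use u in simp)
  qed
  define R where "R = (arcs_ends (D \<restriction> B))\<^sup>+"
  have "acyclic (arcs_ends (D \<restriction> B))"
    by (rule acyclic_induce_subgraph_if_card_less_digirth) fact+
  then have irrefl: "(x, x) \<notin> R" for x by (simp add: acyclic_def R_def)
  \<comment> \<open>Inside \<open>B\<close> the number of ancestors serves as topological order,
    with values at most \<open>card B\<close>. The default value outside exceeds these, so rank
    \<open>Suc (card B)\<close> means having left \<open>B\<close>.\<close>
  define r where "r = (\<lambda>x. if x \<in> B then card {y \<in> B. (y, x) \<in> R} else Suc (card B))"
  have r_less_iff: "r x < Suc (card B) \<longleftrightarrow> x \<in> B" for x
    using card_mono[OF finB, of "{y \<in> B. (y, x) \<in> R}"] by (auto simp: r_def)
  have r_mono: "r x < r y" if "r x < Suc (card B)" "(x, y) \<in> E" for x y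
  proof (cases "y \<in> B")
    case True
    have x: "x \<in> B" using that r_less_iff by simp
    have "(x, y) \<in> arcs_ends (D \<restriction> B)"
      using that(2) E_arcs x True by (fastforce simp: arcs_ends_conv)
    then have xy: "(x, y) \<in> R" by (auto simp: R_def)
    \<comment> \<open>The inclusion is strict because \<open>x\<close> precedes \<open>y\<close>
      but, by acyclicity, not itself.\<close>
    then have "{z \<in> B. (z, x) \<in> R} \<subset> {z \<in> B. (z, y) \<in> R}"
      using x irrefl by (auto simp: R_def)
    then show ?thesis using x True finB by (simp add: r_def psubset_card_mono)
  next
    case False
    then show ?thesis using that(1) by (simp add: r_def)
  qed
  \<comment> \<open>The walk without steps counts because \<open>l\<close> is at least 1.\<close>
  have uB: "u \<in> B" using assms(2) by (auto simp: B_def intro!: bexI[of _ 0])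
  have finF: "finite (F u)" and cardF: "card (F u) = k" using F u by auto
  then have "finite (F u)" "card (F u) \<le> k" by auto
  moreover have "k \<le> card (E `` {x})" if "r x < Suc (card B)" for x
    using that r_less_iff B_verts F by (auto simp: E_Image)
  ultimately obtain p where
    p: "\<forall>a\<in>F u. p a \<noteq> [] \<and> hd (p a) = a \<and> Suc (card B) \<le> r (last (p a))
          \<and> successively (\<lambda>x y. (x, y) \<in> E) (p a) \<and> distinct (p a)
          \<and> (\<forall>x\<in>set (tl (p a)). r a < r x)"
    and disj: "\<forall>a\<in>F u. \<forall>b\<in>F u. a \<noteq> b \<longrightarrow> set (p a) \<inter> set (p b) = {}"
    using disjoint_paths_to_high_rank[of "F u" k r "Suc (card B)" E, OF _ _ _ r_mono] by blast
  note p = bspec[OF p] and disj = disj[rule_format]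
  have uE: "(u, a) \<in> E" if "a \<in> F u" for a using that u by (simp add: E_def)
  \<comment> \<open>The last vertex is \<open>length (p a)\<close> steps away from \<open>u\<close>;
    with fewer than \<open>l\<close> steps it would lie in \<open>B\<close>, against its
    rank.\<close>
  have len: "l \<le> length (p a)" if "a \<in> F u" for a
  proof (rule ccontr)
    assume "\<not> l \<le> length (p a)"
    moreover have "(u, last (p a)) \<in> E ^^ length (p a)"
      using successively_nth_relpow[of E "p a" u "length (p a) - 1"] p[OF that] uE[OF that]
      by (simp add: last_conv_nth del: relpow.simps)
    ultimately have "last (p a) \<in> B" unfolding B_def by force
    then show False using p[OF that] r_less_iff by (metis not_less)
  qed
  \<comment> \<open>Ranks on \<open>p a\<close> are at least \<open>r a\<close>, which exceeds the
    rank of \<open>u\<close>.\<close>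
  have u_notin: "u \<notin> set (p a)" if "a \<in> F u" for a
  proof
    assume "u \<in> set (p a)"
    have "r u < r a" using r_mono uE[OF that] uB r_less_iff by blast
    with \<open>u \<in> set (p a)\<close> p[OF that] show False by (cases "p a") auto
  qed
  obtain n where n: "bij_betw n {..<k} (F u)"
    using finF cardF ex_bij_betw_nat_finite atLeast0LessThan by metis
  then have nF: "n i \<in> F u" if "i < k" for i using that by (auto simp: bij_betw_def)
  \<comment> \<open>Position 0 is taken by \<open>u\<close>, so list indices lag by one. A path may
    be longer than needed; only its first \<open>l\<close> vertices become arm vertices.\<close>
  define g where "g = (\<lambda>(i, j). case j of 0 \<Rightarrow> u | Suc j' \<Rightarrow> p (n i) ! j')"
  have g_Suc: "g (i, Suc j) = p (n i) ! j" for i j by (simp add: g_def)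
  have g_in: "g (i, Suc j) \<in> set (p (n i))" if "i < k" "Suc j \<le> l" for i j
    using len[OF nF[OF that(1)]] that(2) by (simp add: g_Suc)
  show "has_out_spider_at D k l u"
  proof (rule has_out_spider_atI)
    show "g (0, 0) = u" by (simp add: g_def)
  next
    fix i j assume ij: "i < k" "j < l"
    have "(g (arm_vertex i j), g (arm_vertex i (Suc j))) \<in> E"
    proof (cases j)
      case 0
      have "p (n i) ! 0 = n i" using p[OF nF[OF ij(1)]] by (metis hd_conv_nth)
      then show ?thesis using 0 uE[OF nF[OF ij(1)]] by (simp add: arm_vertex_def g_def)
    next
      case (Suc j')
      then show ?thesis
        using p[OF nF[OF ij(1)]] len[OF nF[OF ij(1)]] ij
        by (simp add: arm_vertex_def g_def successively_conv_nth)
    qed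
    then show "(g (arm_vertex i j), g (arm_vertex i (Suc j))) \<in> arcs_ends D"
      using E_arcs by blast
  next
    \<comment> \<open>Disjointness of the paths determines the arm, distinctness within a path the
      position.\<close>
    have inj: "(i, Suc j) = (i', Suc j')"
      if "i < k" "i' < k" "Suc j \<le> l" "Suc j' \<le> l" "g (i, Suc j) = g (i', Suc j')" for i j i' j'
    proof -
      have "n i = n i'"
        using disj[OF nF nF] g_in that by (metis disjoint_iff)
      then have "i = i'" using n that by (auto simp: bij_betw_def inj_on_def)
      moreover have "j = j'"
        using that p[OF nF] len[OF nF] \<open>i = i'\<close>
        by (metis g_Suc less_le_trans nth_eq_iff_index_eq less_eq_Suc_le)
      ultimately show ?thesis by simp
    qed
    have verts: "x = (0, 0) \<or> (\<exists>i j. x = (i, Suc j) \<and> i < k \<and> Suc j \<le> l)"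
      if x: "x \<in> verts (out_spider k l)" for x
    proof -
      consider "x = (0, 0)" | i j where "x = arm_vertex i j" "i < k" "j \<le> l"
        using x by (auto simp: out_spider_def spider_centre_def)
      then show ?thesis
      proof cases
        case 2
        then show ?thesis by (cases j) (auto simp: arm_vertex_def)
      qed simp
    qed
    have g0: "g (0, 0) = u" by (simp add: g_def)
    have ne: "g (i, Suc j) \<noteq> u" if "i < k" "Suc j \<le> l" for i j
      using g_in[OF that] u_notin[OF nF[OF that(1)]] by metis
    show "inj_on g (verts (out_spider k l))"
    proof (rule inj_onI)
      fix x y assume "x \<in> verts (out_spider k l)" "y \<in> verts (out_spider k l)" "g x = g y"
      then show "x = y" using verts[of x] verts[of y] inj ne g0 by metis
    qed
  qed (rule u)
qed

end
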